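(* Let $B\subset\mathbb R^d$ be a convex body and let $V_1\cup\dots\cup V_k=\mathbb R^d$ be an inductive partition of $\mathbb R^d$. Put $C_i=V_i\cap B$ for $i=1,\dots,k$ (so $C_1\cup\dots\cup C_k=B$), and assume every $C_i$ is nonempty. Then \[ \sum_{i=1}^k r_B(C_i)\ge 1. \]
   Context: A convex body is a compact convex set with nonempty interior. A (convex) partition of a convex set $X$ is a covering of $X$ by finitely many closed convex sets with pairwise disjoint interiors. A convex partition $V_1\cup\dots\cup V_k$ of $\mathbb R^d$ is called inductive if for every $1\le i\le k$ there exists an inductive partition $W_1\cup\dots\cup W_{i-1}\cup W_{i+1}\cup\dots\cup W_k$ of $\mathbb R^d$ with $W_j\supseteq V_j$ for all $j\ne i$; the partition into one part $V_1=\mathbb R^d$ is inductive (this is a recursive definition on the number of parts). For a convex body $B\subset\mathbb R^d$ and a convex set $C\subseteq\mathbb R^d$, the relative inradius is $r_B(C)=\sup\{h\ge 0:\exists t\in\mathbb R^d,\ hB+t\subseteq C\}$, with $r_B(\emptyset)=-\infty$. *)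

theory Defs
  imports "HOL-Analysis.Analysis"
begin

definition convex_body :: "'a::euclidean_space set \<Rightarrow> bool" where
  "convex_body B \<longleftrightarrow> compact B \<and> convex B \<and> interior B \<noteq> {}"

definition convex_partition :: "'a::euclidean_space set \<Rightarrow> 'a set list \<Rightarrow> bool" where
  "convex_partition X Vs \<longleftrightarrow>
     (\<forall>V\<in>set Vs. closed V \<and> convex V) \<and> \<Union>(set Vs) = X \<and>
     (\<forall>i<length Vs. \<forall>j<length Vs. i \<noteq> j \<longrightarrow> interior (Vs!i) \<inter> interior (Vs!j) = {})"

inductive inductive_partition :: "'a::euclidean_space set list \<Rightarrow> bool" where
  one: "inductive_partition [UNIV]"
| step: "\<lbrakk>length Vs \<ge> 2; convex_partition UNIV Vs;
          \<forall>i<length Vs. \<exists>Ws. inductive_partition Ws \<and>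
             list_all2 (\<subseteq>) (take i Vs @ drop (Suc i) Vs) Ws\<rbrakk>
         \<Longrightarrow> inductive_partition Vs"

definition rel_inradius :: "'a::euclidean_space set \<Rightarrow> 'a set \<Rightarrow> ereal" where
  "rel_inradius B C =
     (if C = {} then -\<infinity>
      else Sup (ereal ` {h. h \<ge> 0 \<and> (\<exists>t. (\<lambda>x. h *\<^sub>R x + t) ` B \<subseteq> C)}))"

end

theory Submission
  imports Defs
begin

text \<open>
  Slide the body along a direction. For a convex set \<open>V\<close> the inradius of \<open>V \<inter> (x + B)\<close> is
  concave in \<open>x\<close> as long as the intersection is nonempty. Two parts of the partition are
  separated by a hyperplane; along its normal \<open>u\<close>, the set of \<open>t\<close> for which the interior of
  \<open>x + t u + B\<close> meets the interiors of all parts is bounded. At its two end points some part is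
  met only at the boundary, so it may be removed and induction applies; concavity
  transports the bound from the end points to \<open>x\<close>.
\<close>

text \<open>Inserting \<open>0\<close> gives the empty set inradius \<open>0\<close> instead of \<open>-\<infinity>\<close>; only then does the
  bound hold for all translates of \<open>B\<close>, as the induction needs.\<close>

definition inradius :: "'a::euclidean_space set \<Rightarrow> 'a set \<Rightarrow> real" where
  "inradius B C = Sup (insert 0 {h. h \<ge> 0 \<and> (\<exists>t. (\<lambda>x. h *\<^sub>R x + t) ` B \<subseteq> C)})"

section \<open>Elementary properties of the inradius\<close>

text \<open>Compare diameters: translations preserve them, the homothety multiplies them by
  \<open>h\<close>, and \<open>B\<close> has positive diameter because a single point has empty
  interior. This is what makes the real supremum in \<open>inradius\<close> meaningful.\<close>

lemma homothet_in_translate_le_1: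
  fixes B :: "'a::euclidean_space set"
  assumes "convex_body B" "h \<ge> 0" "(\<lambda>x. h *\<^sub>R x + t) ` B \<subseteq> (+) x ` B"
  shows "h \<le> 1"
proof -
  have B: "compact B" "interior B \<noteq> {}"
    using assms(1) by (auto simp: convex_body_def)
  then have "B \<noteq> {}" by auto
  then obtain p q where pq: "p \<in> B" "q \<in> B" and d: "dist p q = diameter B"
    using diameter_compact_attained[OF B(1)] by auto
  have "p \<noteq> q"
  proof
    assume "p = q"
    then have "diameter B = 0" using d by simp
    then have "dist b p \<le> 0" if "b \<in> B" for b
      using diameter_bounded_bound[OF compact_imp_bounded[OF B(1)] that pq(1)] by simp
    then have "B \<subseteq> {p}" by auto
    then have "interior B \<subseteq> interior {p}" by (rule interior_mono)
    then show False using B(2) by simp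
  qed
  have "h *\<^sub>R p + t \<in> (+) x ` B" "h *\<^sub>R q + t \<in> (+) x ` B"
    using assms(3) pq by auto
  then obtain p' q' where p'q': "p' \<in> B" "q' \<in> B" "h *\<^sub>R p + t = x + p'" "h *\<^sub>R q + t = x + q'"
    by (elim imageE)
  have "h * dist p q = dist (h *\<^sub>R p + t) (h *\<^sub>R q + t)"
    using assms(2) by (simp add: dist_norm scaleR_diff_right[symmetric])
  also have "\<dots> = dist p' q'" using p'q' by simp
  also have "\<dots> \<le> dist p q"
    using diameter_bounded_bound[OF compact_imp_bounded[OF B(1)] p'q'(1,2)] d by simp
  finally show ?thesis using \<open>p \<noteq> q\<close> by simp
qed

lemma bdd_above_inradius:
  fixes B :: "'a::euclidean_space set"
  assumes "convex_body B" "C \<subseteq> (+) x ` B"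
  shows "bdd_above (insert 0 {h. h \<ge> 0 \<and> (\<exists>t. (\<lambda>x. h *\<^sub>R x + t) ` B \<subseteq> C)})"
proof (rule bdd_aboveI[where M = 1])
  fix h assume "h \<in> insert 0 {h. h \<ge> 0 \<and> (\<exists>t. (\<lambda>x. h *\<^sub>R x + t) ` B \<subseteq> C)}"
  then consider "h = 0" | t where "h \<ge> 0" "(\<lambda>x. h *\<^sub>R x + t) ` B \<subseteq> C" by auto
  then show "h \<le> 1"
  proof cases
    case 2
    show ?thesis
      by (rule homothet_in_translate_le_1[OF assms(1) 2(1) order_trans[OF 2(2) assms(2)]])
  qed simp
qed

lemma inradius_upper:
  fixes B :: "'a::euclidean_space set"
  assumes "convex_body B" "C \<subseteq> (+) x ` B" "h \<ge> 0" "(\<lambda>x. h *\<^sub>R x + t) ` B \<subseteq> C"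
  shows "h \<le> inradius B C"
  unfolding inradius_def
proof (rule cSup_upper[OF _ bdd_above_inradius[OF assms(1,2)]])
  show "h \<in> insert 0 {h. h \<ge> 0 \<and> (\<exists>t. (\<lambda>x. h *\<^sub>R x + t) ` B \<subseteq> C)}"
    using assms(3,4) by blast
qed

lemma inradius_nonneg:
  fixes B :: "'a::euclidean_space set"
  assumes "convex_body B" "C \<subseteq> (+) x ` B"
  shows "0 \<le> inradius B C"
  unfolding inradius_def by (rule cSup_upper[OF insertI1 bdd_above_inradius[OF assms]])

lemma inradius_least:
  fixes B :: "'a::euclidean_space set"
  assumes "0 \<le> c" "\<And>h t. h > 0 \<Longrightarrow> (\<lambda>x. h *\<^sub>R x + t) ` B \<subseteq> C \<Longrightarrow> h \<le> c"
  shows "inradius B C \<le> c"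
  unfolding inradius_def
proof (rule cSup_least)
  fix h assume "h \<in> insert 0 {h. h \<ge> 0 \<and> (\<exists>t. (\<lambda>x. h *\<^sub>R x + t) ` B \<subseteq> C)}"
  then consider "h = 0" | t where "h > 0" "(\<lambda>x. h *\<^sub>R x + t) ` B \<subseteq> C"
    by (cases "h = 0") auto
  then show "h \<le> c"
  proof cases
    case 2
    then show ?thesis by (rule assms(2))
  qed (use assms(1) in simp)
qed simp

text \<open>The inserted \<open>0\<close> must be realised as well: if \<open>C\<close> has a point
  \<open>y\<close>, then the degenerate homothet with ratio \<open>0\<close> centred at
  \<open>y\<close> lies in \<open>C\<close>.\<close>

lemma inradius_approx:
  fixes B :: "'a::euclidean_space set"
  assumes "C \<noteq> {}" "c < inradius B C"
  obtains h t where "h \<ge> 0" "c < h" "(\<lambda>x. h *\<^sub>R x + t) ` B \<subseteq> C"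
proof -
  obtain h where h: "c < h" "h \<in> insert 0 {h. h \<ge> 0 \<and> (\<exists>t. (\<lambda>x. h *\<^sub>R x + t) ` B \<subseteq> C)}"
    by (rule less_cSupE[OF assms(2)[unfolded inradius_def]]) auto
  from h(2) consider "h = 0" | t where "h \<ge> 0" "(\<lambda>x. h *\<^sub>R x + t) ` B \<subseteq> C" by auto
  then show ?thesis
  proof cases
    case 1
    obtain y where "y \<in> C" using assms(1) by blast
    then show ?thesis using that[of h y] 1 h(1) by auto
  next
    case 2
    then show ?thesis using h(1) by (intro that)
  qed
qed

section \<open>Concavity under translation of the body\<close>

text \<open>A convex combination of two homothets of \<open>B\<close> is a homothet whose ratio is
  the same combination of the ratios. Convexity of \<open>V\<close> keeps it in \<open>V\<close>,
  convexity of \<open>B\<close> keeps it in the intermediate translate. Empty intersections are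
  excluded since their conventional value \<open>0\<close> would break concavity.\<close>

lemma inradius_concave:
  fixes B :: "'a::euclidean_space set"
  assumes "convex_body B" "convex V"
    and "V \<inter> (+) x ` B \<noteq> {}" "V \<inter> (+) y ` B \<noteq> {}"
    and l: "0 \<le> l" "l \<le> 1"
  shows "(1 - l) * inradius B (V \<inter> (+) x ` B) + l * inradius B (V \<inter> (+) y ` B)
          \<le> inradius B (V \<inter> (+) ((1 - l) *\<^sub>R x + l *\<^sub>R y) ` B)" (is "?lhs \<le> ?rhs")
proof (rule field_le_epsilon)
  fix e :: real assume "e > 0"
  let ?z = "(1 - l) *\<^sub>R x + l *\<^sub>R y"
  obtain h s where h: "h \<ge> 0" "inradius B (V \<inter> (+) x ` B) - e < h"
    "(\<lambda>x. h *\<^sub>R x + s) ` B \<subseteq> V \<inter> (+) x ` B"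
    using inradius_approx[OF assms(3), of "inradius B (V \<inter> (+) x ` B) - e" B] \<open>e > 0\<close> by auto
  obtain k t where k: "k \<ge> 0" "inradius B (V \<inter> (+) y ` B) - e < k"
    "(\<lambda>x. k *\<^sub>R x + t) ` B \<subseteq> V \<inter> (+) y ` B"
    using inradius_approx[OF assms(4), of "inradius B (V \<inter> (+) y ` B) - e" B] \<open>e > 0\<close> by auto
  have cB: "convex B" using assms(1) by (simp add: convex_body_def)
  have "(\<lambda>b. ((1 - l) * h + l * k) *\<^sub>R b + ((1 - l) *\<^sub>R s + l *\<^sub>R t)) ` B \<subseteq> V \<inter> (+) ?z ` B"
  proof (rule image_subsetI)
    fix b assume b: "b \<in> B"
    let ?p = "h *\<^sub>R b + s" and ?q = "k *\<^sub>R b + t"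
    have e: "((1 - l) * h + l * k) *\<^sub>R b + ((1 - l) *\<^sub>R s + l *\<^sub>R t) = (1 - l) *\<^sub>R ?p + l *\<^sub>R ?q"
      by (simp add: algebra_simps)
    obtain p q where pq: "p \<in> B" "q \<in> B" "?p = x + p" "?q = y + q"
      using h(3) k(3) b by blast
    have "?p \<in> V" "?q \<in> V" using h(3) k(3) b by auto
    then have 1: "(1 - l) *\<^sub>R ?p + l *\<^sub>R ?q \<in> V"
      using assms(2) l by (intro convexD) auto
    have "(1 - l) *\<^sub>R p + l *\<^sub>R q \<in> B"
      using cB l pq by (intro convexD) auto
    moreover have "(1 - l) *\<^sub>R ?p + l *\<^sub>R ?q = ?z + ((1 - l) *\<^sub>R p + l *\<^sub>R q)"
      unfolding pq by (simp add: algebra_simps)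
    ultimately show "((1 - l) * h + l * k) *\<^sub>R b + ((1 - l) *\<^sub>R s + l *\<^sub>R t) \<in> V \<inter> (+) ?z ` B"
      using 1 unfolding e by auto
  qed
  then have "(1 - l) * h + l * k \<le> ?rhs"
    using h(1) k(1) l
    by (intro inradius_upper[OF assms(1) Int_lower2, rotated]) auto
  moreover have "(1 - l) * (inradius B (V \<inter> (+) x ` B) - e) \<le> (1 - l) * h"
    using h l by (intro mult_left_mono) auto
  moreover have "l * (inradius B (V \<inter> (+) y ` B) - e) \<le> l * k"
    using k l by (intro mult_left_mono) auto
  ultimately show "?lhs \<le> ?rhs + e" by (simp add: algebra_simps)
qed

section \<open>Removing a part that the body misses\<close>

text \<open>A finite form of Baire's theorem: either \<open>U\<close> lies in \<open>V\<close>,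
  hence in its interior, or \<open>U - V\<close> is a nonempty open set covered by the remaining
  members.\<close>

lemma open_covered_by_finite_closed:
  fixes U :: "'a::topological_space set"
  assumes "finite F" "\<forall>V\<in>F. closed V" "open U" "U \<noteq> {}" "U \<subseteq> \<Union>F"
  shows "\<exists>V\<in>F. interior V \<inter> U \<noteq> {}"
  using assms
proof (induction F arbitrary: U rule: finite_induct)
  case (insert V F)
  show ?case
  proof (cases "U \<subseteq> V")
    case True
    then have "U \<subseteq> interior V" using insert.prems by (simp add: interior_maximal)
    then show ?thesis using insert.prems by auto
  next
    case False
    then have "\<exists>V'\<in>F. interior V' \<inter> (U - V) \<noteq> {}"
      using insert.prems by (intro insert.IH open_Diff) auto
    then show ?thesis by blast
  qed
qed simp

text \<open>If \<open>Us\<close> is dense in \<open>K\<close>, enlarging its members to a partition adds nothing inside \<open>K\<close>,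
  except possibly to parts without interior, whose inradius vanishes.\<close>

lemma sum_inradius_enlarged_le:
  fixes B K :: "'a::euclidean_space set"
  assumes B: "convex_body B" and K: "K = (+) x ` B"
    and Ws: "convex_partition UNIV Ws" and sub: "list_all2 (\<subseteq>) Us Ws"
    and closed: "\<forall>V\<in>set Us. closed V"
    and dense: "\<And>U. open U \<Longrightarrow> U \<noteq> {} \<Longrightarrow> U \<subseteq> K \<Longrightarrow> \<exists>V\<in>set Us. interior V \<inter> U \<noteq> {}"
  shows "(\<Sum>W\<leftarrow>Ws. inradius B (W \<inter> K)) \<le> (\<Sum>V\<leftarrow>Us. inradius B (V \<inter> K))"
proof -
  have len: "length Us = length Ws" and subi: "\<And>i. i < length Ws \<Longrightarrow> Us ! i \<subseteq> Ws ! i"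
    using sub by (auto simp: list_all2_conv_all_nth)
  have "inradius B (Ws ! j \<inter> K) \<le> inradius B (Us ! j \<inter> K)" if j: "j < length Ws" for j
  proof (rule inradius_least)
    show "0 \<le> inradius B (Us ! j \<inter> K)" using B K by (intro inradius_nonneg) auto
  next
    fix h t assume h: "h > 0" and hB: "(\<lambda>x. h *\<^sub>R x + t) ` B \<subseteq> Ws ! j \<inter> K"
    define H where "H = (\<lambda>x. h *\<^sub>R x + t) ` B"
    have aff: "(\<lambda>x. h *\<^sub>R x + t) = (\<lambda>x. t + h *\<^sub>R x)" by (simp add: add.commute)
    have "convex H"
      using B unfolding H_def aff convex_body_def by (intro convex_affinity) auto
    moreover have "interior H \<noteq> {}"
    proof -
      have "(\<lambda>x. h *\<^sub>R x + t) ` interior B \<subseteq> interior H"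
      proof (rule interior_maximal)
        show "(\<lambda>x. h *\<^sub>R x + t) ` interior B \<subseteq> H"
          unfolding H_def by (rule image_mono[OF interior_subset])
        show "open ((\<lambda>x. h *\<^sub>R x + t) ` interior B)"
          unfolding aff using h by (intro open_affinity) auto
      qed
      then show ?thesis using B by (auto simp: convex_body_def)
    qed
    \<comment> \<open>Since \<open>h > 0\<close>, the homothet \<open>H\<close> is the closure of
      its interior up to boundary points, so it suffices to place \<open>interior H\<close> in the
      closed set \<open>Us ! j\<close>.\<close>
    ultimately have closure_H: "closure (interior H) = closure H"
      by (rule convex_closure_interior)
    have sub_H: "H \<subseteq> Ws ! j" "H \<subseteq> K" using hB by (simp_all add: H_def)
    have cl: "closed (Us ! j)" using closed j len by auto
    have "interior H - Us ! j = {}"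
    \<comment> \<open>By density, the open remainder would meet the interior of another
      \<open>Us ! i\<close>. Then the interiors of \<open>Ws ! i\<close> and \<open>Ws ! j\<close>
      would overlap.\<close>
    proof (rule ccontr)
      assume ne: "interior H - Us ! j \<noteq> {}"
      have "interior H - Us ! j \<subseteq> K" using sub_H(2) interior_subset[of H] by blast
      then have "\<exists>V\<in>set Us. interior V \<inter> (interior H - Us ! j) \<noteq> {}"
        by (rule dense[OF open_Diff[OF open_interior cl] ne])
      then obtain i where i: "i < length Ws" "interior (Us ! i) \<inter> (interior H - Us ! j) \<noteq> {}"
        by (metis in_set_conv_nth len)
      then have "i \<noteq> j" using interior_subset[of "Us ! i"] by blast
      then have "interior (Ws ! i) \<inter> interior (Ws ! j) = {}"
        using Ws i(1) j unfolding convex_partition_def by blast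
      moreover have "interior (Us ! i) \<subseteq> interior (Ws ! i)"
        using subi[OF i(1)] by (rule interior_mono)
      moreover have "interior H \<subseteq> interior (Ws ! j)" using sub_H(1) by (rule interior_mono)
      ultimately show False using i(2) by blast
    qed
    then have "closure (interior H) \<subseteq> Us ! j"
      using cl by (intro closure_minimal) auto
    then have "H \<subseteq> Us ! j \<inter> K"
      using closure_H closure_subset[of H] sub_H(2) by blast
    then show "h \<le> inradius B (Us ! j \<inter> K)"
      using h unfolding H_def K by (intro inradius_upper[OF B Int_lower2]) auto
  qed
  then show ?thesis
    unfolding sum_list_sum_nth length_map len by (intro sum_mono) (simp add: len)
qed

text \<open>The other parts have interiors dense in \<open>K\<close>, so enlarging them to
  \<open>Ws\<close> does not increase the sum. The removed part contributes a nonnegative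
  term.\<close>

lemma sum_inradius_ge_if_part_missed:
  fixes B K :: "'a::euclidean_space set"
  assumes B: "convex_body B" and K: "K = (+) x ` B"
    and Vs: "convex_partition UNIV Vs" and i: "i < length Vs"
    and missed: "interior (Vs ! i) \<inter> interior K = {}"
    and Ws: "convex_partition UNIV Ws" "list_all2 (\<subseteq>) (take i Vs @ drop (Suc i) Vs) Ws"
    and ge: "1 \<le> (\<Sum>W\<leftarrow>Ws. inradius B (W \<inter> K))"
  shows "1 \<le> (\<Sum>V\<leftarrow>Vs. inradius B (V \<inter> K))"
proof -
  define v Us where "v = Vs ! i" and "Us = take i Vs @ drop (Suc i) Vs"
  have split: "Vs = take i Vs @ v # drop (Suc i) Vs"
    unfolding v_def using i by (rule id_take_nth_drop)
  have set: "set Vs = insert v (set Us)"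
    unfolding Us_def by (subst split) (simp only: set_append set_simps Un_insert_right)
  have closed: "\<forall>V\<in>set Vs. closed V" and cover: "\<Union>(set Vs) = UNIV"
    using Vs by (auto simp only: convex_partition_def)
  have "(\<Sum>W\<leftarrow>Ws. inradius B (W \<inter> K)) \<le> (\<Sum>V\<leftarrow>Us. inradius B (V \<inter> K))"
  proof (rule sum_inradius_enlarged_le[OF B K Ws[folded Us_def]])
    show "\<forall>V\<in>set Us. closed V" using closed set by simp
  next
    fix U assume U: "open U" "U \<noteq> {}" "U \<subseteq> K"
    have "\<exists>V\<in>set Vs. interior V \<inter> U \<noteq> {}"
      using open_covered_by_finite_closed[OF finite_set closed U(1,2)] cover by simp
    moreover have "U \<subseteq> interior K" using U(3,1) by (rule interior_maximal)
    then have "interior v \<inter> U = {}" using missed unfolding v_def by blast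
    ultimately show "\<exists>V\<in>set Us. interior V \<inter> U \<noteq> {}"
      unfolding set by simp
  qed
  moreover have "(\<Sum>V\<leftarrow>Vs. inradius B (V \<inter> K))
      = (\<Sum>V\<leftarrow>Us. inradius B (V \<inter> K)) + inradius B (v \<inter> K)"
    unfolding Us_def by (subst split) (simp only: map_append list.map sum_list_append sum_list.Cons ac_simps)
  moreover have "0 \<le> inradius B (v \<inter> K)"
    unfolding K by (rule inradius_nonneg[OF B Int_lower2])
  ultimately show ?thesis using ge by linarith
qed

section \<open>Sliding the body until a part is missed\<close>

lemma bounded_subset_closure_endpoints:
  fixes T :: "real set"
  assumes "open T" "bounded T" "c \<in> T"
  obtains a b where "a < c" "c < b" "a \<notin> T" "b \<notin> T" "a \<in> closure T" "b \<in> closure T"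
proof -
  have bdd: "bdd_below T" "bdd_above T"
    using assms(2) bounded_imp_bdd_below bounded_imp_bdd_above by auto
  have "\<forall>t\<in>T. Inf T - 1 < t" "\<forall>t\<in>T. t < Sup T + 1"
    using cInf_lower[OF _ bdd(1)] cSup_upper[OF _ bdd(2)] by force+
  then have "Inf T \<notin> T" "Sup T \<notin> T"
    using assms(1) Inf_notin_open Sup_notin_open by blast+
  moreover have "Inf T \<le> c" "c \<le> Sup T"
    using bdd assms(3) by (auto intro: cInf_lower cSup_upper)
  ultimately show ?thesis
    using that[of "Inf T" "Sup T"] assms(3) bdd closure_contains_Inf closure_contains_Sup
    by (metis empty_iff order_le_less)
qed

text \<open>The two end points lie outside the open set \<open>T\<close> of admissible shifts, so
  some part is missed there; they lie in its closure, so every closed part is still touched, as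
  concavity requires.\<close>

lemma sliding_interval:
  fixes B :: "'a::euclidean_space set"
  assumes B: "convex_body B" and Vs: "convex_partition UNIV Vs" and len: "length Vs \<ge> 2"
    and meets: "\<forall>i<length Vs. interior (Vs ! i) \<inter> interior ((+) x ` B) \<noteq> {}"
  obtains u a b where "a < 0" "0 < b"
    and "\<exists>i<length Vs. interior (Vs ! i) \<inter> interior ((+) (x + a *\<^sub>R u) ` B) = {}"
    and "\<exists>i<length Vs. interior (Vs ! i) \<inter> interior ((+) (x + b *\<^sub>R u) ` B) = {}"
    and "\<forall>i<length Vs. Vs ! i \<inter> (+) (x + a *\<^sub>R u) ` B \<noteq> {}"
    and "\<forall>i<length Vs. Vs ! i \<inter> (+) (x + b *\<^sub>R u) ` B \<noteq> {}"
proof -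
  have V: "closed (Vs ! i)" "convex (Vs ! i)" if "i < length Vs" for i
    using Vs that by (auto simp: convex_partition_def)
  have cpt: "compact B" using B by (simp add: convex_body_def)
  have two: "0 < length Vs" "1 < length Vs" using len by auto
  \<comment> \<open>Two parts suffice to find a direction: once a shift along the normal
    \<open>u\<close> is too long, the body lies strictly on one side of the hyperplane separating
    them.\<close>
  have "interior (Vs ! 0) \<inter> interior (Vs ! 1) = {}"
    using Vs two unfolding convex_partition_def by (metis zero_neq_one)
  moreover have "interior (Vs ! 0) \<noteq> {}" "interior (Vs ! 1) \<noteq> {}"
    using meets two by blast+
  moreover have "convex (interior (Vs ! 0))" "convex (interior (Vs ! 1))"
    using V two by (auto intro: convex_interior)
  ultimately obtain u c where u: "u \<noteq> 0" "\<forall>y\<in>interior (Vs ! 0). u \<bullet> y \<le> c"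
    "\<forall>y\<in>interior (Vs ! 1). u \<bullet> y \<ge> c"
    using separating_hyperplane_sets by metis
  define T where "T = {t. \<forall>i<length Vs. interior (Vs ! i) \<inter> interior ((+) (x + t *\<^sub>R u) ` B) \<noteq> {}}"
  have iT: "interior (Vs ! i) \<inter> interior ((+) (x + t *\<^sub>R u) ` B) \<noteq> {}
      \<longleftrightarrow> (\<exists>y\<in>interior B. x + t *\<^sub>R u + y \<in> interior (Vs ! i))" for i t
    unfolding interior_translation by auto
  have "T = (\<Inter>i\<in>{..<length Vs}. \<Union>y\<in>interior B. (\<lambda>t. x + t *\<^sub>R u + y) -` interior (Vs ! i))"
    unfolding T_def iT by auto
  also have "open \<dots>"
    by (intro open_INT ballI open_UN open_vimage continuous_intros) auto
  finally have "open T" .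
  obtain M where M: "\<And>y. y \<in> B \<Longrightarrow> norm y \<le> M"
    using compact_imp_bounded[OF cpt] unfolding bounded_iff by auto
  have "\<bar>t\<bar> \<le> (\<bar>c\<bar> + norm u * (norm x + M)) / (u \<bullet> u)" if t: "t \<in> T" for t
  proof -
    have bd: "\<bar>u \<bullet> (x + y)\<bar> \<le> norm u * (norm x + M)" if "y \<in> interior B" for y
    proof -
      have "\<bar>u \<bullet> (x + y)\<bar> \<le> norm u * norm (x + y)" by (rule Cauchy_Schwarz_ineq2)
      also have "\<dots> \<le> norm u * (norm x + M)"
        using that M[of y] interior_subset[of B] norm_triangle_ineq[of x y]
        by (intro mult_left_mono) auto
      finally show ?thesis .
    qed
    have "\<forall>i<length Vs. \<exists>y\<in>interior B. x + t *\<^sub>R u + y \<in> interior (Vs ! i)"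
      using t unfolding T_def iT by simp
    then obtain y z where yz: "y \<in> interior B" "z \<in> interior B"
      "x + t *\<^sub>R u + y \<in> interior (Vs ! 0)" "x + t *\<^sub>R u + z \<in> interior (Vs ! 1)"
      using two by metis
    \<comment> \<open>The translate has points on both sides of the hyperplane, which bounds
      \<open>t * (u \<bullet> u)\<close> from above and from below.\<close>
    have "t * (u \<bullet> u) + u \<bullet> (x + y) \<le> c" "c \<le> t * (u \<bullet> u) + u \<bullet> (x + z)"
      using bspec[OF u(2) yz(3)] bspec[OF u(3) yz(4)] by (simp_all add: inner_add_right)
    then have "\<bar>t * (u \<bullet> u)\<bar> \<le> \<bar>c\<bar> + norm u * (norm x + M)"
      using bd[OF yz(1)] bd[OF yz(2)] by linarith
    then have "\<bar>t\<bar> * (u \<bullet> u) \<le> \<bar>c\<bar> + norm u * (norm x + M)" by (simp add: abs_mult)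
    then show ?thesis using u(1) by (simp add: pos_le_divide_eq)
  qed
  then have "bounded T" by (intro boundedI) auto
  moreover have "0 \<in> T" using meets by (simp add: T_def)
  ultimately obtain a b where ab: "a < 0" "0 < b" "a \<notin> T" "b \<notin> T" "a \<in> closure T" "b \<in> closure T"
    using bounded_subset_closure_endpoints \<open>open T\<close> by metis
  have "Vs ! i \<inter> (+) (x + t *\<^sub>R u) ` B \<noteq> {}" if i: "i < length Vs" and t: "t \<in> closure T" for i t
  proof -
    \<comment> \<open>\<open>?D\<close> is the Minkowski difference of the part and
      \<open>B\<close>: the translate of \<open>B\<close> by \<open>p\<close> meets the part exactly
      when \<open>p\<close> is in \<open>?D\<close>. It is closed, being closed minus compact, so
      touching survives the passage to the closure of \<open>T\<close>.\<close>
    let ?D = "\<Union>v\<in>Vs ! i. \<Union>y\<in>B. {v - y}"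
    let ?S = "(\<lambda>t. x + t *\<^sub>R u) -` ?D"
    have "closed ?S"
      by (intro closed_vimage closed_compact_differences[OF V(1)[OF i] cpt] continuous_intros)
    moreover have "T \<subseteq> ?S"
    proof
      fix t assume "t \<in> T"
      then obtain y where "y \<in> interior B" "x + t *\<^sub>R u + y \<in> interior (Vs ! i)"
        using i unfolding T_def iT by auto
      then have "y \<in> B" "x + t *\<^sub>R u + y \<in> Vs ! i" by (auto dest: interior_subset[THEN subsetD])
      moreover have "x + t *\<^sub>R u \<in> {(x + t *\<^sub>R u + y) - y}" by simp
      ultimately have "x + t *\<^sub>R u \<in> ?D" by blast
      then show "t \<in> ?S" by (rule vimageI2)
    qed
    ultimately have "closure T \<subseteq> ?S" by (intro closure_minimal)
    then have "t \<in> ?S" using t by (rule subsetD)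
    then obtain v y where "v \<in> Vs ! i" "y \<in> B" "x + t *\<^sub>R u = v - y" by auto
    then have "v \<in> Vs ! i \<inter> (+) (x + t *\<^sub>R u) ` B" by (auto intro!: image_eqI[of _ _ y])
    then show ?thesis by blast
  qed
  with ab(5,6) have "\<forall>i<length Vs. Vs ! i \<inter> (+) (x + a *\<^sub>R u) ` B \<noteq> {}"
    "\<forall>i<length Vs. Vs ! i \<inter> (+) (x + b *\<^sub>R u) ` B \<noteq> {}" by auto
  moreover have "\<exists>i<length Vs. interior (Vs ! i) \<inter> interior ((+) (x + a *\<^sub>R u) ` B) = {}"
    "\<exists>i<length Vs. interior (Vs ! i) \<inter> interior ((+) (x + b *\<^sub>R u) ` B) = {}"
    using ab(3,4) unfolding T_def by simp_all
  ultimately show ?thesis by (intro that[OF ab(1,2)])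
qed

section \<open>Induction over the partition\<close>

lemma inductive_partition_convex_partition:
  "inductive_partition Vs \<Longrightarrow> convex_partition UNIV Vs"
  by (induction rule: inductive_partition.induct) (auto simp: convex_partition_def)

text \<open>The bound is proved for all translates at once, because the induction hypothesis is
  applied at the end points of the slide and not only at \<open>x\<close>.\<close>

theorem sum_inradius_ge_1:
  fixes B :: "'a::euclidean_space set"
  assumes "inductive_partition Vs" and B: "convex_body B"
  shows "1 \<le> (\<Sum>V\<leftarrow>Vs. inradius B (V \<inter> (+) x ` B))"
  using assms(1)
proof (induction arbitrary: x rule: inductive_partition.induct)
  case one
  show ?case using B by (auto intro!: inradius_upper[of _ _ x _ x] simp: add.commute)
next
  case (step Vs)
  \<comment> \<open>The induction hypothesis enters only here; \<open>z\<close> is general so that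
    this serves for \<open>x\<close> itself and for both end points.\<close>
  have missed: "1 \<le> (\<Sum>V\<leftarrow>Vs. inradius B (V \<inter> (+) z ` B))"
    if z: "\<exists>i<length Vs. interior (Vs ! i) \<inter> interior ((+) z ` B) = {}" for z
  proof -
    obtain i where i: "i < length Vs" "interior (Vs ! i) \<inter> interior ((+) z ` B) = {}"
      using z by blast
    obtain Ws where "inductive_partition Ws" "list_all2 (\<subseteq>) (take i Vs @ drop (Suc i) Vs) Ws"
      "1 \<le> (\<Sum>W\<leftarrow>Ws. inradius B (W \<inter> (+) z ` B))"
      using step.IH i(1) by blast
    then show ?thesis
      using sum_inradius_ge_if_part_missed[OF B refl step.hyps(2) i]
        inductive_partition_convex_partition by blast
  qed
  show ?case
  proof (cases "\<exists>i<length Vs. interior (Vs ! i) \<inter> interior ((+) x ` B) = {}")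
    case True
    then show ?thesis by (rule missed)
  next
    case False
    then obtain u a b where ab: "a < 0" "0 < b"
      and miss: "\<exists>i<length Vs. interior (Vs ! i) \<inter> interior ((+) (x + a *\<^sub>R u) ` B) = {}"
        "\<exists>i<length Vs. interior (Vs ! i) \<inter> interior ((+) (x + b *\<^sub>R u) ` B) = {}"
      and meet: "\<forall>i<length Vs. Vs ! i \<inter> (+) (x + a *\<^sub>R u) ` B \<noteq> {}"
        "\<forall>i<length Vs. Vs ! i \<inter> (+) (x + b *\<^sub>R u) ` B \<noteq> {}"
      using sliding_interval[OF B step.hyps(2,1), of x] by metis
    \<comment> \<open>This weight solves \<open>(1 - l) * a + l * b = 0\<close>, which makes
      \<open>x\<close> the corresponding convex combination of the two end points.\<close>
    define l where "l = - a / (b - a)"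
    have l: "0 \<le> l" "l \<le> 1" using ab by (auto simp: l_def field_simps)
    have "(1 - l) * a + l * b = a + l * (b - a)" by (simp add: algebra_simps)
    also have "\<dots> = 0" using ab by (simp add: l_def)
    finally have "((1 - l) * a + l * b) *\<^sub>R u = 0" by simp
    then have x: "(1 - l) *\<^sub>R (x + a *\<^sub>R u) + l *\<^sub>R (x + b *\<^sub>R u) = x"
      by (simp add: algebra_simps)
    let ?f = "\<lambda>z V. inradius B (V \<inter> (+) z ` B)"
    have "1 = (1 - l) * 1 + l * 1" by simp
    also have "\<dots> \<le> (1 - l) * (\<Sum>V\<leftarrow>Vs. ?f (x + a *\<^sub>R u) V) + l * (\<Sum>V\<leftarrow>Vs. ?f (x + b *\<^sub>R u) V)"
      using l missed[OF miss(1)] missed[OF miss(2)] by (intro add_mono mult_left_mono) auto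
    also have "\<dots> = (\<Sum>V\<leftarrow>Vs. (1 - l) * ?f (x + a *\<^sub>R u) V + l * ?f (x + b *\<^sub>R u) V)"
      by (simp add: sum_list_addf sum_list_const_mult)
    \<comment> \<open>Concavity is applied to each part separately; \<open>meet\<close> supplies the
      nonempty intersections at both ends.\<close>
    also have "\<dots> \<le> (\<Sum>V\<leftarrow>Vs. ?f x V)"
    proof (rule sum_list_mono)
      fix V assume V: "V \<in> set Vs"
      then have "V \<inter> (+) (x + a *\<^sub>R u) ` B \<noteq> {}" "V \<inter> (+) (x + b *\<^sub>R u) ` B \<noteq> {}"
        using meet by (metis in_set_conv_nth)+
      moreover have "convex V" using V step.hyps(2) by (simp add: convex_partition_def)
      ultimately show "(1 - l) * ?f (x + a *\<^sub>R u) V + l * ?f (x + b *\<^sub>R u) V \<le> ?f x V"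
        using inradius_concave[OF B _ _ _ l, of V "x + a *\<^sub>R u" "x + b *\<^sub>R u"] unfolding x by blast
    qed
    finally show ?thesis .
  qed
qed

section \<open>Return to the extended-real inradius\<close>

lemma inradius_le_rel_inradius:
  fixes B :: "'a::euclidean_space set"
  assumes "C \<noteq> {}"
  shows "ereal (inradius B C) \<le> rel_inradius B C"
proof (rule ccontr)
  let ?S = "{h. h \<ge> 0 \<and> (\<exists>t. (\<lambda>x. h *\<^sub>R x + t) ` B \<subseteq> C)}"
  have r: "rel_inradius B C = Sup (ereal ` ?S)" using assms unfolding rel_inradius_def by (rule if_not_P)
  assume "\<not> ?thesis"
  then have "rel_inradius B C < ereal (inradius B C)" by simp
  \<comment> \<open>A real \<open>c\<close> strictly between the two values is exceeded by the ratio
    of some homothet in \<open>C\<close>, which \<open>rel_inradius\<close> also counts.\<close>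
  then obtain c where c: "rel_inradius B C < ereal c" "c < inradius B C"
    using ereal_dense2 by (metis less_ereal.simps(1))
  obtain h t where "h \<ge> 0" "c < h" "(\<lambda>x. h *\<^sub>R x + t) ` B \<subseteq> C"
    by (rule inradius_approx[OF assms c(2)])
  then have "ereal h \<le> rel_inradius B C" unfolding r by (intro Sup_upper) blast
  also have "\<dots> < ereal c" by (rule c(1))
  finally show False using \<open>c < h\<close> by simp
qed

theorem mainTheorem1:
  fixes B :: "'a::euclidean_space set" and Vs :: "'a set list"
  assumes "convex_body B"
    and "inductive_partition Vs"
    and "\<forall>i<length Vs. Vs!i \<inter> B \<noteq> {}"
  shows "(\<Sum>i<length Vs. rel_inradius B (Vs!i \<inter> B)) \<ge> 1"
proof -
  have "1 \<le> (\<Sum>i<length Vs. inradius B (Vs!i \<inter> B))"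
    using sum_inradius_ge_1[OF assms(2,1), of 0]
    by (simp add: sum_list_sum_nth atLeast0LessThan)
  then have "1 \<le> ereal (\<Sum>i<length Vs. inradius B (Vs!i \<inter> B))" by simp
  also have "\<dots> = (\<Sum>i<length Vs. ereal (inradius B (Vs!i \<inter> B)))" by simp
  \<comment> \<open>Nonemptiness of the pieces enters here: on the empty set
    \<open>rel_inradius\<close> is minus infinity while \<open>inradius\<close> is
    \<open>0\<close>.\<close>
  also have "\<dots> \<le> (\<Sum>i<length Vs. rel_inradius B (Vs!i \<inter> B))"
    using assms(3) by (intro sum_mono inradius_le_rel_inradius) auto
  finally show ?thesis .
qed

end
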